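(* Let $(\mathcal{U},\tau_{\mathcal{R}}(\mathcal{M}))$ and $(\mathcal{V},\sigma_{\mathcal{R}}(\mathcal{N}))$ be nano topological spaces and let $h:\mathcal{U}\to\mathcal{V}$ be a map. (i) If $h$ is N-open, N-continuous and bijective, then $h$ is N$\alpha^{*}$-continuous. (ii) $h:(\mathcal{U},\tau_{\mathcal{R}}(\mathcal{M}))\to(\mathcal{V},\sigma_{\mathcal{R}}(\mathcal{N}))$ is N$\alpha^{*}$-continuous if and only if $h:(\mathcal{U},\tau_{\mathcal{R}}\alpha(\mathcal{M}))\to(\mathcal{V},\sigma_{\mathcal{R}}\alpha(\mathcal{N}))$ is N-continuous, i.e. continuous when $\mathcal{U}$ and $\mathcal{V}$ carry the families $\tau_{\mathcal{R}}\alpha(\mathcal{M})$ and $\sigma_{\mathcal{R}}\alpha(\mathcal{N})$ as their families of open sets.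
   Context: Nano topological space: let $\mathcal{U}$ be a non-empty finite set (the universe), $\mathcal{R}$ an equivalence relation on $\mathcal{U}$ and $\mathcal{M}\subseteq\mathcal{U}$. The lower approximation $L$ of $\mathcal{M}$ is the union of the $\mathcal{R}$-classes contained in $\mathcal{M}$, the upper approximation $H$ is the union of the $\mathcal{R}$-classes meeting $\mathcal{M}$, and $B=H\setminus L$ is the boundary. Then $\tau_{\mathcal{R}}(\mathcal{M})=\{\emptyset,\mathcal{U},L,H,B\}$ is a topology on $\mathcal{U}$, and $(\mathcal{U},\tau_{\mathcal{R}}(\mathcal{M}))$ is called a nano topological space. Each space has its own equivalence relation; the symbol $\mathcal{R}$ is used for all of them. Members of $\tau_{\mathcal{R}}(\mathcal{M})$ are called N-open and their complements N-closed; $\mathrm{Nint}$ and $\mathrm{Ncl}$ denote interior and closure in this topology. A subset $\mathcal{D}\subseteq\mathcal{U}$ is N$\alpha$-open if $\mathcal{D}\subseteq\mathrm{Nint}(\mathrm{Ncl}(\mathrm{Nint}(\mathcal{D})))$; $\tau_{\mathcal{R}}\alpha(\mathcal{M})$ denotes the family of all N$\alpha$-open subsets of $\mathcal{U}$ (and $\sigma_{\mathcal{R}}\alpha(\mathcal{N})$ the analogous family for $\mathcal{V}$). A map $h:\mathcal{U}\to\mathcal{V}$ is: N-continuous if the preimage of every N-open set in $\mathcal{V}$ is N-open in $\mathcal{U}$; N-open if the image of every N-open set in $\mathcal{U}$ is N-open in $\mathcal{V}$; N$\alpha^{*}$-continuous if the preimage of every N$\alpha$-open set in $\mathcal{V}$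 is N$\alpha$-open in $\mathcal{U}$. *)

theory Defs
  imports "HOL-Analysis.Analysis"
begin

definition lower_approx :: "'a set \<Rightarrow> ('a \<times> 'a) set \<Rightarrow> 'a set \<Rightarrow> 'a set" where
  "lower_approx U R M = \<Union>{C \<in> U // R. C \<subseteq> M}"

definition upper_approx :: "'a set \<Rightarrow> ('a \<times> 'a) set \<Rightarrow> 'a set \<Rightarrow> 'a set" where
  "upper_approx U R M = \<Union>{C \<in> U // R. C \<inter> M \<noteq> {}}"

definition boundary_region :: "'a set \<Rightarrow> ('a \<times> 'a) set \<Rightarrow> 'a set \<Rightarrow> 'a set" where
  "boundary_region U R M = upper_approx U R M - lower_approx U R M"

definition nano_opens :: "'a set \<Rightarrow> ('a \<times> 'a) set \<Rightarrow> 'a set \<Rightarrow> 'a set set" where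
  "nano_opens U R M =
     {{}, U, lower_approx U R M, upper_approx U R M, boundary_region U R M}"

definition nano_space :: "'a set \<Rightarrow> ('a \<times> 'a) set \<Rightarrow> 'a set \<Rightarrow> bool" where
  "nano_space U R M \<longleftrightarrow> finite U \<and> U \<noteq> {} \<and> equiv U R \<and> M \<subseteq> U"

(* Only meaningful if nano_space U R M holds; see openin_nano_topology. *)
definition nano_topology :: "'a set \<Rightarrow> ('a \<times> 'a) set \<Rightarrow> 'a set \<Rightarrow> 'a topology" where
  "nano_topology U R M = topology (\<lambda>S. S \<in> nano_opens U R M)"

definition alpha_open :: "'a topology \<Rightarrow> 'a set \<Rightarrow> bool" where
  "alpha_open X D \<longleftrightarrow> D \<subseteq> topspace X \<and>
     D \<subseteq> X interior_of (X closure_of (X interior_of D))"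

(* The alpha-open sets of any topology form a topology; see openin_alpha_topology. *)
definition alpha_topology :: "'a topology \<Rightarrow> 'a topology" where
  "alpha_topology X = topology (alpha_open X)"

definition alpha_star_continuous ::
    "'a topology \<Rightarrow> 'b topology \<Rightarrow> ('a \<Rightarrow> 'b) \<Rightarrow> bool" where
  "alpha_star_continuous X Y h \<longleftrightarrow> h \<in> topspace X \<rightarrow> topspace Y \<and>
     (\<forall>D. alpha_open Y D \<longrightarrow> alpha_open X {x \<in> topspace X. h x \<in> D})"

lemma lower_subset_upper:
  assumes "equiv U R"
  shows "lower_approx U R M \<subseteq> upper_approx U R M"
proof -
  have "C \<inter> M \<noteq> {}" if "C \<in> U // R" "C \<subseteq> M" for C
    using in_quotient_imp_non_empty[OF assms that(1)] that(2) by blast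
  then show ?thesis
    unfolding lower_approx_def upper_approx_def by blast
qed

lemma upper_subset:
  assumes "equiv U R"
  shows "upper_approx U R M \<subseteq> U"
  using in_quotient_imp_subset[OF assms] unfolding upper_approx_def by blast

lemma istopology_nano_opens:
  assumes "nano_space U R M"
  shows "istopology (\<lambda>S. S \<in> nano_opens U R M)"
proof -
  let ?L = "lower_approx U R M" and ?H = "upper_approx U R M"
  have e: "equiv U R"
    using assms by (simp add: nano_space_def)
  have LH: "?L \<subseteq> ?H" and HU: "?H \<subseteq> U"
    using lower_subset_upper[OF e] upper_subset[OF e] by auto
  have inter: "S \<inter> T \<in> nano_opens U R M"
    if "S \<in> nano_opens U R M" "T \<in> nano_opens U R M" for S T
  proof -
    have "?L \<inter> ?H = ?L" "?H \<inter> ?L = ?L" "?L \<inter> U = ?L" "U \<inter> ?L = ?L"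
      "?H \<inter> U = ?H" "U \<inter> ?H = ?H" "?L \<inter> (?H - ?L) = {}" "(?H - ?L) \<inter> ?L = {}"
      "?H \<inter> (?H - ?L) = ?H - ?L" "(?H - ?L) \<inter> ?H = ?H - ?L"
      "U \<inter> (?H - ?L) = ?H - ?L" "(?H - ?L) \<inter> U = ?H - ?L"
      using LH HU by blast+
    then show ?thesis
      using that unfolding nano_opens_def boundary_region_def by (elim insertE emptyE) simp_all
  qed
  have un: "S \<union> T \<in> nano_opens U R M"
    if "S \<in> nano_opens U R M" "T \<in> nano_opens U R M" for S T
  proof -
    have "?L \<union> ?H = ?H" "?H \<union> ?L = ?H" "?L \<union> U = U" "U \<union> ?L = U"
      "?H \<union> U = U" "U \<union> ?H = U" "?L \<union> (?H - ?L) = ?H" "(?H - ?L) \<union> ?L = ?H"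
      "?H \<union> (?H - ?L) = ?H" "(?H - ?L) \<union> ?H = ?H"
      "U \<union> (?H - ?L) = U" "(?H - ?L) \<union> U = U"
      using LH HU by blast+
    then show ?thesis
      using that unfolding nano_opens_def boundary_region_def by (elim insertE emptyE) simp_all
  qed
  have "\<Union>K \<in> nano_opens U R M" if K: "\<forall>S\<in>K. S \<in> nano_opens U R M" for K
  proof -
    have "finite K"
      using K finite_subset[of K "nano_opens U R M"] by (auto simp: nano_opens_def)
    then show ?thesis
      using K
    proof (induction K)
      case empty
      then show ?case by (simp add: nano_opens_def)
    next
      case (insert S K)
      then show ?case using un by simp
    qed
  qed
  with inter show ?thesis
    by (simp add: istopology_def)
qed

lemma openin_nano_topology:
  assumes "nano_space U R M"
  shows "openin (nano_topology U R M) S \<longleftrightarrow> S \<in> nano_opens U R M"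
  unfolding nano_topology_def
  by (simp add: istopology_nano_opens[OF assms])

lemma topspace_nano_topology:
  assumes "nano_space U R M"
  shows "topspace (nano_topology U R M) = U"
proof -
  have e: "equiv U R"
    using assms by (simp add: nano_space_def)
  have sub: "S \<subseteq> U" if "S \<in> nano_opens U R M" for S
    using that lower_subset_upper[OF e, of M] upper_subset[OF e, of M]
    unfolding nano_opens_def boundary_region_def by (elim insertE emptyE) auto
  have "openin (nano_topology U R M) U"
    unfolding openin_nano_topology[OF assms] by (simp add: nano_opens_def)
  then have "U \<subseteq> topspace (nano_topology U R M)"
    by (rule openin_subset)
  moreover have "topspace (nano_topology U R M) \<subseteq> U"
    using openin_topspace sub unfolding openin_nano_topology[OF assms, symmetric] by metis
  ultimately show ?thesis
    by (rule equalityI[rotated])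
qed

lemma istopology_alpha_open: "istopology (alpha_open X)"
proof -
  have inter: "alpha_open X (S \<inter> T)" if S: "alpha_open X S" and T: "alpha_open X T" for S T
  proof -
    let ?A = "X interior_of S" and ?B = "X interior_of T"
    let ?G = "X interior_of (X closure_of ?A)" and ?K = "X interior_of (X closure_of ?B)"
    have "?G \<inter> ?K \<subseteq> X closure_of (?A \<inter> ?B)"
    proof -
      have "?G \<inter> ?K \<subseteq> ?K \<inter> X closure_of ?A"
        using interior_of_subset[of X "X closure_of ?A"] by blast
      also have "\<dots> \<subseteq> X closure_of (?K \<inter> ?A)"
        by (simp add: openin_Int_closure_of_subset)
      also have "\<dots> \<subseteq> X closure_of (?A \<inter> X closure_of ?B)"
        using interior_of_subset[of X "X closure_of ?B"] by (intro closure_of_mono) blast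
      also have "\<dots> \<subseteq> X closure_of (X closure_of (?A \<inter> ?B))"
        by (intro closure_of_mono openin_Int_closure_of_subset) simp
      finally show ?thesis by simp
    qed
    then have "?G \<inter> ?K \<subseteq> X interior_of (X closure_of (?A \<inter> ?B))"
      by (intro interior_of_maximal) auto
    then show ?thesis
      using S T unfolding alpha_open_def interior_of_Int by blast
  qed
  have "alpha_open X (\<Union>K)" if K: "\<forall>S\<in>K. alpha_open X S" for K
  proof -
    have "S \<subseteq> X interior_of (X closure_of (X interior_of (\<Union>K)))" if "S \<in> K" for S
    proof -
      have "S \<subseteq> X interior_of (X closure_of (X interior_of S))"
        using K that by (simp add: alpha_open_def)
      also have "\<dots> \<subseteq> X interior_of (X closure_of (X interior_of (\<Union>K)))"
        using that by (intro interior_of_mono closure_of_mono) blast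
      finally show ?thesis .
    qed
    moreover have "\<Union>K \<subseteq> topspace X"
      using K by (auto simp: alpha_open_def)
    ultimately show ?thesis
      unfolding alpha_open_def by blast
  qed
  with inter show ?thesis
    by (simp add: istopology_def)
qed

lemma openin_alpha_topology: "openin (alpha_topology X) S \<longleftrightarrow> alpha_open X S"
  unfolding alpha_topology_def by (simp add: istopology_alpha_open)

lemma topspace_alpha_topology: "topspace (alpha_topology X) = topspace X"
proof (rule equalityI)
  have "alpha_open X (topspace (alpha_topology X))"
    unfolding openin_alpha_topology[symmetric] by (rule openin_topspace)
  then show "topspace (alpha_topology X) \<subseteq> topspace X"
    by (simp add: alpha_open_def)
  have "alpha_open X (topspace X)"
    by (simp add: alpha_open_def)
  then show "topspace X \<subseteq> topspace (alpha_topology X)"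
    unfolding openin_alpha_topology[symmetric] by (rule openin_subset)
qed

end

theory Submission
  imports Defs
begin

text \<open>
  For an open map, preimage and closure satisfy \<open>h\<^sup>-\<^sup>1 (cl A) \<subseteq> cl (h\<^sup>-\<^sup>1 A)\<close>. If moreover \<open>h\<close>
  is continuous, then for an \<open>\<alpha>\<close>-open set \<open>D\<close> with interior \<open>A\<close> the open set
  \<open>h\<^sup>-\<^sup>1 (int (cl A))\<close> contains \<open>h\<^sup>-\<^sup>1 D\<close> and lies in the closure of the open set
  \<open>h\<^sup>-\<^sup>1 A \<subseteq> h\<^sup>-\<^sup>1 D\<close>, so \<open>h\<^sup>-\<^sup>1 D\<close> is \<open>\<alpha>\<close>-open.
\<close>

text \<open>An open neighbourhood \<open>T\<close> of \<open>x\<close> has as image an open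
  neighbourhood of \<open>h x\<close>, which therefore meets \<open>A\<close>; a point of
  \<open>T\<close> sent into \<open>A\<close> lies in the preimage.\<close>

lemma open_map_preimage_closure_of:
  assumes "open_map X Y h"
  shows "{x \<in> topspace X. h x \<in> Y closure_of A} \<subseteq> X closure_of {x \<in> topspace X. h x \<in> A}"
proof clarify
  fix x
  assume x: "x \<in> topspace X" and hx: "h x \<in> Y closure_of A"
  have "\<exists>z. z \<in> {x \<in> topspace X. h x \<in> A} \<and> z \<in> T" if "x \<in> T" "openin X T" for T
  proof -
    have "openin Y (h ` T)" and "h x \<in> h ` T"
      using assms that by (simp_all add: open_map_def)
    then obtain y where "y \<in> A" "y \<in> h ` T"
      using hx by (metis in_closure_of)
    then show ?thesis
      using openin_subset[OF that(2)] by auto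
  qed
  with x show "x \<in> X closure_of {x \<in> topspace X. h x \<in> A}"
    by (simp add: in_closure_of)
qed

lemma alpha_open_preimage:
  assumes "open_map X Y h" and cont: "continuous_map X Y h" and D: "alpha_open Y D"
  shows "alpha_open X {x \<in> topspace X. h x \<in> D}"
proof -
  let ?pre = "\<lambda>B. {x \<in> topspace X. h x \<in> B}"
  let ?A = "Y interior_of D"
  let ?G = "Y interior_of (Y closure_of ?A)"
  have "openin X (?pre ?A)" and open_G: "openin X (?pre ?G)"
    by (rule openin_continuous_map_preimage[OF cont openin_interior_of])+
  moreover have "?pre ?A \<subseteq> ?pre D"
    using interior_of_subset[of Y D] by blast
  ultimately have pre_A: "?pre ?A \<subseteq> X interior_of (?pre D)"
    by (intro interior_of_maximal)
  have "?pre ?G \<subseteq> ?pre (Y closure_of ?A)"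
    using interior_of_subset[of Y "Y closure_of ?A"] by blast
  also have "\<dots> \<subseteq> X closure_of (?pre ?A)"
    using assms(1) by (rule open_map_preimage_closure_of)
  also have "\<dots> \<subseteq> X closure_of (X interior_of (?pre D))"
    using pre_A by (rule closure_of_mono)
  \<comment> \<open>Continuity makes \<open>?pre ?G\<close> open, so its inclusion in the closure
    improves to one in the interior of that closure.\<close>
  finally have "?pre ?G \<subseteq> X interior_of (X closure_of (X interior_of (?pre D)))"
    using open_G by (rule interior_of_maximal)
  moreover have "?pre D \<subseteq> ?pre ?G"
    using D unfolding alpha_open_def by blast
  ultimately show ?thesis
    unfolding alpha_open_def by blast
qed

lemma open_continuous_imp_alpha_star_continuous:
  assumes "open_map X Y h" and "continuous_map X Y h"
  shows "alpha_star_continuous X Y h"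
  using alpha_open_preimage[OF assms] continuous_map_funspace[OF assms(2)]
  by (simp add: alpha_star_continuous_def)

text \<open>The open sets of \<open>alpha_topology\<close> are exactly the \<alpha>-open sets and
  its carrier is that of the original space, so both sides unfold to the same condition.\<close>

lemma alpha_star_continuous_iff_continuous_map:
  "alpha_star_continuous X Y h \<longleftrightarrow> continuous_map (alpha_topology X) (alpha_topology Y) h"
  by (simp add: alpha_star_continuous_def continuous_map_def
      openin_alpha_topology topspace_alpha_topology)

theorem theorem3p10:
  fixes U :: "'a set" and R :: "('a \<times> 'a) set" and M :: "'a set"
    and V :: "'b set" and Q :: "('b \<times> 'b) set" and N :: "'b set"
    and h :: "'a \<Rightarrow> 'b"
  assumes "nano_space U R M"
    and "nano_space V Q N"
    and "h \<in> U \<rightarrow> V"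
  shows "(open_map (nano_topology U R M) (nano_topology V Q N) h
            \<and> continuous_map (nano_topology U R M) (nano_topology V Q N) h
            \<and> bij_betw h U V
          \<longrightarrow> alpha_star_continuous (nano_topology U R M) (nano_topology V Q N) h)
       \<and> (alpha_star_continuous (nano_topology U R M) (nano_topology V Q N) h
          \<longleftrightarrow> continuous_map (alpha_topology (nano_topology U R M))
                              (alpha_topology (nano_topology V Q N)) h)"
  by (simp add: open_continuous_imp_alpha_star_continuous
      alpha_star_continuous_iff_continuous_map[symmetric])

end
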